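(* Let $G$ be a group and let $R$ be a $G$-graded ring. a) Let $M$ be a cancellable monoid. Consider the following statements: (i) $(R[M]_{[G]})^*=R^*$; (ii) $R[M]^*=R^*$; (iii) $M$ is sharp. Then (i) implies (ii), and (ii) and (iii) are equivalent. If $R$ is entire and $M$ is torsionfree, then (i), (ii) and (iii) are equivalent. b) Let $M$ be a sharp, torsionfree, cancellable monoid, let $d\colon M\to G$ be a morphism of monoids, and suppose that $R$ is reduced. Then $R[M;d]^*=R^*$.
   Context: Groups and monoids are commutative and written additively; rings are commutative with $1$. A $G$-graded ring is a ring $R$ with a family $(R_g)_{g\in G}$ of additive subgroups whose direct sum is $R$ and with $R_gR_h\subseteq R_{g+h}$. For a graded ring $R$, $R^*$ denotes the multiplicative group of invertible homogeneous elements of $R$. A graded ring is entire if it is nonzero and every nonzero homogeneous element is a non-zerodivisor; it is reduced if no nonzero homogeneous element is nilpotent. For a monoid $M$, $\mathrm{Diff}(M)$ is its group of differences (Grothendieck group). $M$ is cancellable if and only if the canonical morphism $M\to\mathrm{Diff}(M)$ is injective. A cancellable monoid $M$ is torsionfree if and only if the group $\mathrm{Diff}(M)$ is torsionfree. $M$ is sharp if its only invertible element is $0$. For a cancellable monoid $M$, $R[M]$ is the monoid algebra of $M$ over the ring underlying $R$, with canonical basis $(e_m)_{m\in M}$, furnished with the $G\oplus\mathrm{Diff}(M)$-graduation for which $re_m$ has degree $(g,m)$ for $r\in R_g$, $m\in M$. For a morphism of monoids $d\colon M\to G$, $R[M;d]$ is the same algebra with the $G$-graduation for which $re_m$ has degree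 $g+d(m)$. $R[M]_{[G]}$ is the same algebra with the $G$-graduation for which $re_m$ has degree $g$ (i.e. $R[M;0]$). The ring $R$ is regarded as a subring of all these algebras via $r\mapsto re_0$, so that $R^*$ is regarded as a set of elements of them.
   Formalization: In a), the implication from (ii) to (iii) is stated only for R nonzero: if R = 0 then R[M]^* = R^* = {0} for every M, for example M = Z, which is not sharp, so (ii) holds and (iii) fails. *)

theory Defs
  imports "HOL-Library.Poly_Mapping" "HOL-Library.Product_Plus"
begin

text \<open>
  A commutative ring with 1 is a type of sort
  \<open>{comm_ring, comm_monoid_mult}\<close>; unlike \<open>comm_ring_1\<close>, this sort does not
  exclude the zero ring.
\<close>

section \<open>Commutative monoids and their groups of differences\<close>

definition cancellable_monoid :: "'m::comm_monoid_add itself \<Rightarrow> bool" where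
  "cancellable_monoid _ \<longleftrightarrow> (\<forall>a b c :: 'm. a + c = b + c \<longrightarrow> a = b)"

definition sharp_monoid :: "'m::comm_monoid_add itself \<Rightarrow> bool" where
  "sharp_monoid _ \<longleftrightarrow> (\<forall>m n :: 'm. m + n = 0 \<longrightarrow> m = 0)"

definition monoid_morphism :: "('m::comm_monoid_add \<Rightarrow> 'n::comm_monoid_add) \<Rightarrow> bool" where
  "monoid_morphism d \<longleftrightarrow> d 0 = 0 \<and> (\<forall>m n. d (m + n) = d m + d n)"

definition diff_rel :: "'m::comm_monoid_add \<times> 'm \<Rightarrow> 'm \<times> 'm \<Rightarrow> bool" where
  "diff_rel p q \<longleftrightarrow> (\<exists>k. fst p + snd q + k = fst q + snd p + k)"

lemma equivp_diff_rel: "equivp diff_rel"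
proof (rule equivpI)
  show "reflp diff_rel" by (auto simp: reflp_def diff_rel_def)
  show "symp diff_rel" by (auto simp: symp_def diff_rel_def) metis
  show "transp diff_rel"
  proof (rule transpI)
    fix x y z
    assume "diff_rel x y" "diff_rel y z"
    then obtain k l where
      k: "fst x + snd y + k = fst y + snd x + k" and
      l: "fst y + snd z + l = fst z + snd y + l"
      by (auto simp: diff_rel_def)
    have "fst x + snd z + (snd y + k + l) = (fst x + snd y + k) + (snd z + l)"
      by (simp add: ac_simps)
    also have "\<dots> = (fst y + snd z + l) + (snd x + k)"
      unfolding k by (simp add: ac_simps)
    also have "\<dots> = fst z + snd x + (snd y + k + l)"
      unfolding l by (simp add: ac_simps)
    finally show "diff_rel x z" unfolding diff_rel_def by blast
  qed
qed

quotient_type (overloaded) 'm Diff = "'m::comm_monoid_add \<times> 'm" / diff_rel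
  by (rule equivp_diff_rel)

instantiation Diff :: (comm_monoid_add) ab_group_add
begin

lift_definition zero_Diff :: "'a Diff" is "(0, 0)" .

lift_definition plus_Diff :: "'a Diff \<Rightarrow> 'a Diff \<Rightarrow> 'a Diff"
  is "\<lambda>p q. (fst p + fst q, snd p + snd q)"
proof -
  fix p p' q q' :: "'a \<times> 'a"
  assume "diff_rel p p'" "diff_rel q q'"
  then obtain k l where
    k: "fst p + snd p' + k = fst p' + snd p + k" and
    l: "fst q + snd q' + l = fst q' + snd q + l"
    by (auto simp: diff_rel_def)
  have "(fst p + fst q) + (snd p' + snd q') + (k + l)
      = (fst p + snd p' + k) + (fst q + snd q' + l)"
    by (simp add: ac_simps)
  also have "\<dots> = (fst p' + fst q') + (snd p + snd q) + (k + l)"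
    unfolding k l by (simp add: ac_simps)
  finally show "diff_rel (fst p + fst q, snd p + snd q) (fst p' + fst q', snd p' + snd q')"
    unfolding diff_rel_def fst_conv snd_conv by blast
qed

lift_definition uminus_Diff :: "'a Diff \<Rightarrow> 'a Diff" is "\<lambda>p. (snd p, fst p)"
  by (auto simp: diff_rel_def) (metis add.commute)

definition minus_Diff :: "'a Diff \<Rightarrow> 'a Diff \<Rightarrow> 'a Diff" where
  "minus_Diff x y = x + - y"

instance
proof
  fix x y z :: "'a Diff"
  show "x + y + z = x + (y + z)"
    by transfer (auto simp: diff_rel_def ac_simps)
  show "x + y = y + x"
    by transfer (auto simp: diff_rel_def ac_simps)
  show "0 + x = x"
    by transfer (auto simp: diff_rel_def)
  show "- x + x = 0"
    by transfer (auto simp: diff_rel_def ac_simps)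
  show "x - y = x + - y"
    by (rule minus_Diff_def)
qed

end

lift_definition diff_of :: "'m::comm_monoid_add \<Rightarrow> 'm Diff" is "\<lambda>m. (m, 0)" .

lemma monoid_morphism_diff_of: "monoid_morphism diff_of"
  unfolding monoid_morphism_def
  by (intro conjI allI; transfer) (auto simp: diff_rel_def)

lemma diff_of_eq_iff: "diff_of a = diff_of b \<longleftrightarrow> (\<exists>k. a + k = b + k)"
  by transfer (simp add: diff_rel_def)

lemma Diff_cases: obtains a b where "x = diff_of a - diff_of b"
proof -
  have "\<exists>a b. x = diff_of a + - diff_of b"
    by transfer (auto simp: diff_rel_def)
  then show thesis using that by (metis diff_conv_add_uminus)
qed

lemma cancellable_monoid_iff_inj:
  "cancellable_monoid TYPE('m::comm_monoid_add) \<longleftrightarrow> inj (diff_of :: 'm \<Rightarrow> 'm Diff)"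
  unfolding cancellable_monoid_def inj_def diff_of_eq_iff by metis

definition torsionfree_group :: "'g::ab_group_add itself \<Rightarrow> bool" where
  "torsionfree_group _ \<longleftrightarrow> (\<forall>(x :: 'g) (n :: nat). n > 0 \<longrightarrow> (\<Sum>_<n. x) = 0 \<longrightarrow> x = 0)"

text \<open>Only meant for cancellable monoids; see \<open>torsionfree_monoid_iff\<close>.\<close>

definition torsionfree_monoid :: "'m::comm_monoid_add itself \<Rightarrow> bool" where
  "torsionfree_monoid _ \<longleftrightarrow> torsionfree_group TYPE('m Diff)"

lemma torsionfree_monoid_iff:
  assumes "cancellable_monoid TYPE('m::comm_monoid_add)"
  shows "torsionfree_monoid TYPE('m) \<longleftrightarrow>
    (\<forall>(a :: 'm) b (n :: nat). n > 0 \<longrightarrow> (\<Sum>_<n. a) = (\<Sum>_<n. b) \<longrightarrow> a = b)"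
proof -
  have inj: "diff_of a = diff_of b \<longleftrightarrow> a = b" for a b :: 'm
    using assms unfolding cancellable_monoid_iff_inj by (auto dest: injD)
  have hom: "diff_of (\<Sum>_<n. a) = (\<Sum>_<n. diff_of a)" for a :: 'm and n :: nat
    using monoid_morphism_diff_of[where ?'a = 'm]
    by (induction n) (auto simp: monoid_morphism_def)
  have *: "(\<Sum>_<n. diff_of a - diff_of b) = 0 \<longleftrightarrow> (\<Sum>_<n. a) = (\<Sum>_<n. b)"
    for a b :: 'm and n :: nat
    by (simp add: sum_subtractf flip: hom inj)
  show ?thesis
    unfolding torsionfree_monoid_def torsionfree_group_def
    by (metis * Diff_cases inj eq_iff_diff_eq_0)
qed

section \<open>Graded rings\<close>

definition direct_sum_family :: "('g \<Rightarrow> 'a::ab_group_add set) \<Rightarrow> bool" where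
  "direct_sum_family A \<longleftrightarrow>
    (\<forall>x. \<exists>!f :: 'g \<Rightarrow>\<^sub>0 'a. (\<forall>g. Poly_Mapping.lookup f g \<in> A g) \<and>
       x = (\<Sum>g\<in>Poly_Mapping.keys f. Poly_Mapping.lookup f g))"

definition graded_ring :: "('g::ab_group_add \<Rightarrow> 'a::comm_ring set) \<Rightarrow> bool" where
  "graded_ring A \<longleftrightarrow>
    (\<forall>g. 0 \<in> A g \<and> (\<forall>x\<in>A g. \<forall>y\<in>A g. x + y \<in> A g) \<and> (\<forall>x\<in>A g. - x \<in> A g)) \<and>
    direct_sum_family A \<and>
    (\<forall>g h. \<forall>x\<in>A g. \<forall>y\<in>A h. x * y \<in> A (g + h))"

definition homogeneous :: "('g \<Rightarrow> 'a set) \<Rightarrow> 'a set" where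
  "homogeneous A = (\<Union>g. A g)"

definition entire_graded :: "('g \<Rightarrow> 'a::comm_ring set) \<Rightarrow> bool" where
  "entire_graded A \<longleftrightarrow>
    (\<exists>x :: 'a. x \<noteq> 0) \<and>
    (\<forall>x\<in>homogeneous A. x \<noteq> 0 \<longrightarrow> (\<forall>y. x * y = 0 \<longrightarrow> y = 0))"

definition reduced_graded :: "('g \<Rightarrow> 'a::{comm_ring, comm_monoid_mult} set) \<Rightarrow> bool" where
  "reduced_graded A \<longleftrightarrow> (\<forall>x\<in>homogeneous A. (\<exists>n. x ^ n = 0) \<longrightarrow> x = 0)"

text \<open>
  The first argument is the identity element of the ring. It is explicit because
  the library provides \<open>1\<close> on \<open>'m \<Rightarrow>\<^sub>0 'r\<close> only for \<open>'r\<close> with \<open>0 \<noteq> 1\<close>.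
\<close>

definition homogeneous_units :: "'a::comm_ring \<Rightarrow> ('g \<Rightarrow> 'a set) \<Rightarrow> 'a set" where
  "homogeneous_units e A = {x \<in> homogeneous A. \<exists>y. x * y = e}"

section \<open>Monoid algebras and their graduations\<close>

text \<open>
  The monoid algebra of \<open>M\<close> over \<open>R\<close> is the library's convolution ring
  \<open>'m \<Rightarrow>\<^sub>0 'r\<close>, with \<open>Poly_Mapping.single m r\<close> for \<open>r e_m\<close>.
  \<open>alg_coarse R d\<close> is the graduation of \<open>R[M;d]\<close> and
  \<open>alg_fine R\<close> that of \<open>R[M]\<close>; both are gradings by
  \<open>graded_ring_alg_coarse\<close> and \<open>graded_ring_alg_fine\<close>.
\<close>

definition alg_one :: "'m::comm_monoid_add \<Rightarrow>\<^sub>0 'r::{comm_ring, comm_monoid_mult}" where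
  "alg_one = Poly_Mapping.single 0 1"

definition alg_const :: "'r::zero \<Rightarrow> ('m::comm_monoid_add \<Rightarrow>\<^sub>0 'r)" where
  "alg_const r = Poly_Mapping.single 0 r"

definition alg_coarse :: "('g::ab_group_add \<Rightarrow> 'r::zero set) \<Rightarrow> ('m \<Rightarrow> 'g) \<Rightarrow> 'g \<Rightarrow> ('m \<Rightarrow>\<^sub>0 'r) set" where
  "alg_coarse R d g = {p. \<forall>m\<in>Poly_Mapping.keys p. \<exists>h. Poly_Mapping.lookup p m \<in> R h \<and> h + d m = g}"

definition alg_fine ::
    "('g \<Rightarrow> 'r::zero set) \<Rightarrow> 'g \<times> 'm::comm_monoid_add Diff \<Rightarrow> ('m \<Rightarrow>\<^sub>0 'r) set" where
  "alg_fine R = (\<lambda>(g, x). {p. \<forall>m\<in>Poly_Mapping.keys p. Poly_Mapping.lookup p m \<in> R g \<and> diff_of m = x})"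

lemma poly_mapping_decomp:
  "p = (\<Sum>m\<in>Poly_Mapping.keys p. Poly_Mapping.single m (Poly_Mapping.lookup p m))"
  by (rule poly_mapping_eqI)
    (auto simp: lookup_sum lookup_single when_def in_keys_iff sum.delta)

lemma alg_one_mult: "alg_one * p = p"
proof -
  have "alg_one * p = alg_one * (\<Sum>m\<in>Poly_Mapping.keys p. Poly_Mapping.single m (Poly_Mapping.lookup p m))"
    by (simp flip: poly_mapping_decomp)
  also have "\<dots> = (\<Sum>m\<in>Poly_Mapping.keys p. Poly_Mapping.single m (Poly_Mapping.lookup p m))"
    by (simp add: sum_distrib_left alg_one_def mult_single)
  finally show ?thesis by (simp flip: poly_mapping_decomp)
qed

lemma sum_keys_superset:
  assumes "finite K" "Poly_Mapping.keys f \<subseteq> K"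
  shows "(\<Sum>g\<in>K. Poly_Mapping.lookup f g) = (\<Sum>g\<in>Poly_Mapping.keys f. Poly_Mapping.lookup f g)"
  by (rule sum.mono_neutral_right) (use assms in \<open>auto simp: in_keys_iff\<close>)

lemma direct_sum_familyI:
  fixes A :: "'g \<Rightarrow> 'a::ab_group_add set"
  assumes sub: "\<And>g x y. x \<in> A g \<Longrightarrow> y \<in> A g \<Longrightarrow> x - y \<in> A g"
    and ex: "\<And>x. \<exists>f :: 'g \<Rightarrow>\<^sub>0 'a. (\<forall>g. Poly_Mapping.lookup f g \<in> A g) \<and>
       x = (\<Sum>g\<in>Poly_Mapping.keys f. Poly_Mapping.lookup f g)"
    and ind: "\<And>f :: 'g \<Rightarrow>\<^sub>0 'a. (\<And>g. Poly_Mapping.lookup f g \<in> A g) \<Longrightarrow>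
       (\<Sum>g\<in>Poly_Mapping.keys f. Poly_Mapping.lookup f g) = 0 \<Longrightarrow> f = 0"
  shows "direct_sum_family A"
  unfolding direct_sum_family_def
proof (intro allI ex_ex1I)
  fix x f f'
  assume f: "(\<forall>g. Poly_Mapping.lookup f g \<in> A g) \<and> x = (\<Sum>g\<in>Poly_Mapping.keys f. Poly_Mapping.lookup f g)"
    and f': "(\<forall>g. Poly_Mapping.lookup f' g \<in> A g) \<and> x = (\<Sum>g\<in>Poly_Mapping.keys f'. Poly_Mapping.lookup f' g)"
  have "(\<Sum>g\<in>Poly_Mapping.keys (f - f'). Poly_Mapping.lookup (f - f') g)
      = (\<Sum>g\<in>Poly_Mapping.keys f \<union> Poly_Mapping.keys f'. Poly_Mapping.lookup f g - Poly_Mapping.lookup f' g)"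
    by (rule sum.mono_neutral_cong_left) (auto simp: in_keys_iff lookup_minus)
  also have "\<dots> = (\<Sum>g\<in>Poly_Mapping.keys f \<union> Poly_Mapping.keys f'. Poly_Mapping.lookup f g)
      - (\<Sum>g\<in>Poly_Mapping.keys f \<union> Poly_Mapping.keys f'. Poly_Mapping.lookup f' g)"
    by (rule sum_subtractf)
  also have "(\<Sum>g\<in>Poly_Mapping.keys f \<union> Poly_Mapping.keys f'. Poly_Mapping.lookup f g) = x"
    using f by (subst sum_keys_superset) auto
  also have "(\<Sum>g\<in>Poly_Mapping.keys f \<union> Poly_Mapping.keys f'. Poly_Mapping.lookup f' g) = x"
    using f' by (subst sum_keys_superset) auto
  finally have "f - f' = 0"
    using f f' by (intro ind) (auto simp: lookup_minus sub)
  then show "f = f'" by simp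
qed (use ex in blast)

lemma graded_ring_direct_sum_zero:
  fixes A :: "'g::ab_group_add \<Rightarrow> 'a::comm_ring set"
  assumes "graded_ring A" "finite S" "\<And>g. F g \<in> A g" "\<And>g. g \<notin> S \<Longrightarrow> F g = 0" "(\<Sum>g\<in>S. F g) = 0"
  shows "F g = 0"
proof -
  define f where "f = Poly_Mapping.Abs_poly_mapping F"
  have "finite {g. F g \<noteq> 0}"
    by (rule finite_subset[OF _ assms(2)]) (use assms(4) in auto)
  then have lk: "Poly_Mapping.lookup f = F"
    unfolding f_def by simp
  have "(\<Sum>g\<in>Poly_Mapping.keys f. Poly_Mapping.lookup f g) = (\<Sum>g\<in>S. F g)"
    by (rule sum.mono_neutral_cong_left) (use assms lk in \<open>auto simp: in_keys_iff\<close>)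
  with assms lk have "(\<forall>g. Poly_Mapping.lookup f g \<in> A g) \<and> 0 = (\<Sum>g\<in>Poly_Mapping.keys f. Poly_Mapping.lookup f g)"
    by simp
  moreover have "(\<forall>g. Poly_Mapping.lookup (0 :: 'g \<Rightarrow>\<^sub>0 'a) g \<in> A g) \<and>
      0 = (\<Sum>g\<in>Poly_Mapping.keys (0 :: 'g \<Rightarrow>\<^sub>0 'a). Poly_Mapping.lookup (0 :: 'g \<Rightarrow>\<^sub>0 'a) g)"
    using assms(1) by (simp add: graded_ring_def)
  ultimately have "f = 0"
    using assms(1) unfolding graded_ring_def direct_sum_family_def by blast
  then show ?thesis using lk by (metis lookup_zero)
qed

lemma alg_coarse_eq:
  assumes "graded_ring R"
  shows "alg_coarse R d g = {p. \<forall>m. Poly_Mapping.lookup p m \<in> R (g - d m)}"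
proof -
  have zero: "0 \<in> R h" for h using assms by (simp add: graded_ring_def)
  have "h + d m = g \<longleftrightarrow> h = g - d m" for h m
    by (rule eq_diff_eq[symmetric])
  then have "(\<exists>h. x \<in> R h \<and> h + d m = g) \<longleftrightarrow> x \<in> R (g - d m)" for x m
    by simp
  then have "p \<in> alg_coarse R d g \<longleftrightarrow> (\<forall>m. Poly_Mapping.lookup p m \<in> R (g - d m))" for p
    unfolding alg_coarse_def mem_Collect_eq Ball_def in_keys_iff by (metis zero)
  then show ?thesis by blast
qed

lemma graded_ring_alg_coarse:
  fixes R :: "'g::ab_group_add \<Rightarrow> 'r::comm_ring set" and d :: "'m::comm_monoid_add \<Rightarrow> 'g"
  assumes R: "graded_ring R" and d: "monoid_morphism d"
  shows "graded_ring (alg_coarse R d)"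
proof -
  let ?B = "alg_coarse R d"
  have zero: "0 \<in> R h" and add: "x \<in> R h \<Longrightarrow> y \<in> R h \<Longrightarrow> x + y \<in> R h"
    and neg: "x \<in> R h \<Longrightarrow> - x \<in> R h"
    and mult: "x \<in> R h \<Longrightarrow> y \<in> R h' \<Longrightarrow> x * y \<in> R (h + h')" for h h' x y
    using R by (auto simp: graded_ring_def)
  note eq = alg_coarse_eq[OF R, of d]
  have zeroB: "0 \<in> ?B h" and addB: "x \<in> ?B h \<Longrightarrow> y \<in> ?B h \<Longrightarrow> x + y \<in> ?B h"
    and negB: "x \<in> ?B h \<Longrightarrow> - x \<in> ?B h" for h x y
    by (simp_all add: eq zero add neg lookup_add)
  have sumB: "(\<And>i. i \<in> S \<Longrightarrow> f i \<in> ?B h) \<Longrightarrow> (\<Sum>i\<in>S. f i) \<in> ?B h" for S h and f :: "'i \<Rightarrow> _"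
    by (induction S rule: infinite_finite_induct) (auto intro: zeroB addB)
  have singleB: "Poly_Mapping.single m r \<in> ?B h" if "r \<in> R k" "k + d m = h" for m r k h
    using that unfolding alg_coarse_def by (auto simp: lookup_single when_def split: if_splits)
  have multB: "p * q \<in> ?B (g + h)" if p: "p \<in> ?B g" and q: "q \<in> ?B h" for p q g h
  proof -
    have "p * q = (\<Sum>m\<in>Poly_Mapping.keys p. \<Sum>n\<in>Poly_Mapping.keys q.
        Poly_Mapping.single (m + n) (Poly_Mapping.lookup p m * Poly_Mapping.lookup q n))"
      by (subst poly_mapping_decomp[of p], subst poly_mapping_decomp[of q]) (simp add: sum_product mult_single)
    also have "\<dots> \<in> ?B (g + h)"
    proof (intro sumB)
      fix m n
      have "Poly_Mapping.lookup p m * Poly_Mapping.lookup q n \<in> R ((g - d m) + (h - d n))"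
        using p q by (auto simp: eq intro: mult)
      then show "Poly_Mapping.single (m + n) (Poly_Mapping.lookup p m * Poly_Mapping.lookup q n) \<in> ?B (g + h)"
        by (rule singleB) (use d in \<open>simp add: monoid_morphism_def\<close>)
    qed
    finally show ?thesis .
  qed
  define rep where "rep f p \<longleftrightarrow> (\<forall>g. Poly_Mapping.lookup f g \<in> ?B g) \<and>
      p = (\<Sum>g\<in>Poly_Mapping.keys f. Poly_Mapping.lookup f g)" for f p
  have rep0: "rep 0 0" by (simp add: rep_def zeroB)
  have rep_add: "rep (f + f') (p + q)" if f: "rep f p" and f': "rep f' q" for f f' p q
  proof -
    let ?K = "Poly_Mapping.keys f \<union> Poly_Mapping.keys f'"
    have "(\<Sum>g\<in>Poly_Mapping.keys (f + f'). Poly_Mapping.lookup (f + f') g)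
        = (\<Sum>g\<in>?K. Poly_Mapping.lookup f g + Poly_Mapping.lookup f' g)"
      by (rule sum.mono_neutral_cong_left) (auto simp: in_keys_iff lookup_add)
    also have "\<dots> = (\<Sum>g\<in>?K. Poly_Mapping.lookup f g) + (\<Sum>g\<in>?K. Poly_Mapping.lookup f' g)"
      by (rule sum.distrib)
    also have "(\<Sum>g\<in>?K. Poly_Mapping.lookup f g) = p"
      using f unfolding rep_def by (subst sum_keys_superset) auto
    also have "(\<Sum>g\<in>?K. Poly_Mapping.lookup f' g) = q"
      using f' unfolding rep_def by (subst sum_keys_superset) auto
    finally show ?thesis using f f' by (auto simp: rep_def lookup_add addB)
  qed
  have rep_sum: "\<exists>f. rep f (\<Sum>i\<in>S. P i)" if "\<And>i. i \<in> S \<Longrightarrow> \<exists>f. rep f (P i)"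
    for S and P :: "'i \<Rightarrow> _"
    using that
  proof (induction S rule: infinite_finite_induct)
    case (insert i S)
    then obtain f f' where "rep f (P i)" "rep f' (\<Sum>i\<in>S. P i)" by (metis insert_iff)
    from rep_add[OF this] insert.hyps show ?case by (metis sum.insert)
  qed (use rep0 in auto)
  have rep_single: "\<exists>f. rep f (Poly_Mapping.single m r)" if "r \<in> R k" for m r k
  proof (cases "r = 0")
    case True
    then show ?thesis using rep0 by auto
  next
    case False
    have "Poly_Mapping.single m r \<noteq> 0" using False by (metis lookup_single_eq lookup_zero)
    then have "rep (Poly_Mapping.single (k + d m) (Poly_Mapping.single m r)) (Poly_Mapping.single m r)"
      using that by (auto simp: rep_def lookup_single when_def intro: singleB zeroB)
    then show ?thesis by blast
  qed
  have rep_single': "\<exists>f. rep f (Poly_Mapping.single m r)" for m r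
  proof -
    obtain u where u: "\<forall>g. Poly_Mapping.lookup u g \<in> R g"
      "r = (\<Sum>g\<in>Poly_Mapping.keys u. Poly_Mapping.lookup u g)"
      using R unfolding graded_ring_def direct_sum_family_def by metis
    have "Poly_Mapping.single m r = (\<Sum>g\<in>Poly_Mapping.keys u. Poly_Mapping.single m (Poly_Mapping.lookup u g))"
      by (subst u(2), rule poly_mapping_eqI) (simp add: lookup_sum lookup_single when_def)
    moreover have "\<exists>f. rep f (\<Sum>g\<in>Poly_Mapping.keys u. Poly_Mapping.single m (Poly_Mapping.lookup u g))"
      by (rule rep_sum, rule rep_single) (use u(1) in blast)
    ultimately show ?thesis by simp
  qed
  have ex: "\<exists>f. rep f p" for p
    by (subst poly_mapping_decomp[of p], rule rep_sum, rule rep_single')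
  have "direct_sum_family ?B"
  proof (rule direct_sum_familyI)
    show "x - y \<in> ?B g" if "x \<in> ?B g" "y \<in> ?B g" for x y g
      using addB[OF that(1) negB[OF that(2)]] by simp
    show "\<exists>f. (\<forall>g. Poly_Mapping.lookup f g \<in> ?B g) \<and>
      p = (\<Sum>g\<in>Poly_Mapping.keys f. Poly_Mapping.lookup f g)" for p
      using ex unfolding rep_def .
  next
    fix f :: "'g \<Rightarrow>\<^sub>0 'm \<Rightarrow>\<^sub>0 'r"
    assume f: "\<And>g. Poly_Mapping.lookup f g \<in> ?B g"
      and s: "(\<Sum>g\<in>Poly_Mapping.keys f. Poly_Mapping.lookup f g) = 0"
    have "Poly_Mapping.lookup (Poly_Mapping.lookup f g) m = 0" for g m
    proof -
      define F where "F h = Poly_Mapping.lookup (Poly_Mapping.lookup f (h + d m)) m" for h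
      have "F (g - d m) = 0"
      proof (rule graded_ring_direct_sum_zero[OF R, of "(\<lambda>h. h - d m) ` Poly_Mapping.keys f"])
        show "F h \<in> R h" for h
        proof -
          have "Poly_Mapping.lookup (Poly_Mapping.lookup f (h + d m)) m \<in> R (h + d m - d m)"
            using f[of "h + d m"] unfolding eq by blast
          then show ?thesis by (simp add: F_def)
        qed
        show "F h = 0" if "h \<notin> (\<lambda>h. h - d m) ` Poly_Mapping.keys f" for h
        proof -
          have "h + d m \<notin> Poly_Mapping.keys f"
            using that by (metis add_diff_cancel_right' image_eqI)
          then show ?thesis by (simp add: F_def in_keys_iff)
        qed
        have "(\<Sum>h\<in>(\<lambda>h. h - d m) ` Poly_Mapping.keys f. F h)
            = (\<Sum>h\<in>Poly_Mapping.keys f. Poly_Mapping.lookup (Poly_Mapping.lookup f h) m)"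
          by (subst sum.reindex) (auto simp: inj_on_def F_def)
        also have "\<dots> = Poly_Mapping.lookup (\<Sum>h\<in>Poly_Mapping.keys f. Poly_Mapping.lookup f h) m"
          by (simp add: lookup_sum)
        finally show "(\<Sum>h\<in>(\<lambda>h. h - d m) ` Poly_Mapping.keys f. F h) = 0"
          by (simp add: s)
      qed simp
      then show ?thesis by (simp add: F_def)
    qed
    then show "f = 0"
      by (intro poly_mapping_eqI) simp
  qed
  then show ?thesis
    unfolding graded_ring_def using zeroB addB negB multB by blast
qed

lemma graded_ring_alg_fine:
  fixes R :: "'g::ab_group_add \<Rightarrow> 'r::comm_ring set"
  assumes R: "graded_ring R"
  shows "graded_ring (alg_fine R :: 'g \<times> 'm::comm_monoid_add Diff \<Rightarrow> ('m \<Rightarrow>\<^sub>0 'r) set)"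
proof -
  define C :: "'g \<times> 'm Diff \<Rightarrow> 'r set" where "C = (\<lambda>(g, x). if x = 0 then R g else {0})"
  have zero: "0 \<in> R h" and add: "x \<in> R h \<Longrightarrow> y \<in> R h \<Longrightarrow> x + y \<in> R h"
    and neg: "x \<in> R h \<Longrightarrow> - x \<in> R h"
    and mult: "x \<in> R h \<Longrightarrow> y \<in> R h' \<Longrightarrow> x * y \<in> R (h + h')" for h h' x y
    using R by (auto simp: graded_ring_def)
  have "direct_sum_family C"
  proof (rule direct_sum_familyI)
    show "x - y \<in> C g" if "x \<in> C g" "y \<in> C g" for x y g
      using that add[OF _ neg, of x "fst g" y] by (auto simp: C_def split: prod.splits if_splits)
  next
    fix r
    obtain u where u: "\<forall>g. Poly_Mapping.lookup u g \<in> R g"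
      "r = (\<Sum>g\<in>Poly_Mapping.keys u. Poly_Mapping.lookup u g)"
      using R unfolding graded_ring_def direct_sum_family_def by metis
    define F :: "'g \<times> 'm Diff \<Rightarrow> 'r" where "F = (\<lambda>(g, x). if x = 0 then Poly_Mapping.lookup u g else 0)"
    have supp: "{z. F z \<noteq> 0} = (\<lambda>g. (g, 0)) ` Poly_Mapping.keys u"
      by (auto simp: F_def in_keys_iff image_iff split: if_splits)
    then have "finite {z. F z \<noteq> 0}" by simp
    then have lk: "Poly_Mapping.lookup (Poly_Mapping.Abs_poly_mapping F) = F" by simp
    have "Poly_Mapping.keys (Poly_Mapping.Abs_poly_mapping F) = {z. F z \<noteq> 0}"
      using lk by (auto simp: in_keys_iff)
    then have "(\<Sum>z\<in>Poly_Mapping.keys (Poly_Mapping.Abs_poly_mapping F). F z) = r"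
      unfolding supp u(2) by (simp add: sum.reindex inj_on_def) (simp add: F_def)
    then show "\<exists>f. (\<forall>g. Poly_Mapping.lookup f g \<in> C g) \<and>
      r = (\<Sum>g\<in>Poly_Mapping.keys f. Poly_Mapping.lookup f g)"
      using u(1) lk by (intro exI[of _ "Poly_Mapping.Abs_poly_mapping F"]) (auto simp: C_def F_def)
  next
    fix f :: "'g \<times> 'm Diff \<Rightarrow>\<^sub>0 'r"
    assume f: "\<And>z. Poly_Mapping.lookup f z \<in> C z"
      and s: "(\<Sum>z\<in>Poly_Mapping.keys f. Poly_Mapping.lookup f z) = 0"
    have nz: "Poly_Mapping.lookup f (g, x) = 0" if "x \<noteq> 0" for g x
      using f[of "(g, x)"] that by (simp add: C_def)
    then have keys: "Poly_Mapping.keys f = (\<lambda>g. (g, 0)) ` fst ` Poly_Mapping.keys f"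
    proof -
      have "(fst z, 0) = z" if "z \<in> Poly_Mapping.keys f" for z
        using that nz by (cases z) (auto simp: in_keys_iff)
      then show ?thesis by (simp add: image_image)
    qed
    have "(\<Sum>g\<in>fst ` Poly_Mapping.keys f. Poly_Mapping.lookup f (g, 0)) = 0"
      using s by (subst (asm) keys) (simp add: sum.reindex inj_on_def)
    then have "Poly_Mapping.lookup f (g, 0) = 0" for g
    proof (rule graded_ring_direct_sum_zero[OF R, of "fst ` Poly_Mapping.keys f" "\<lambda>g. Poly_Mapping.lookup f (g, 0)", rotated -1])
      show "Poly_Mapping.lookup f (h, 0) \<in> R h" for h
        using f[of "(h, 0)"] by (simp add: C_def)
      show "Poly_Mapping.lookup f (h, 0) = 0" if "h \<notin> fst ` Poly_Mapping.keys f" for h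
      proof -
        have "(h, 0) \<notin> Poly_Mapping.keys f"
          using that by (metis fst_conv image_eqI)
        then show ?thesis by (simp add: in_keys_iff)
      qed
    qed simp
    with nz show "f = 0"
      by (intro poly_mapping_eqI) (auto split: prod.splits, metis)
  qed
  then have C: "graded_ring C"
    unfolding graded_ring_def
    by (auto simp: C_def zero add neg mult)
  have d: "monoid_morphism (\<lambda>m :: 'm. (0 :: 'g, diff_of m))"
    using monoid_morphism_diff_of[where ?'a = 'm]
    by (auto simp: monoid_morphism_def zero_prod_def)
  have "alg_coarse C (\<lambda>m :: 'm. (0, diff_of m)) = alg_fine R"
  proof (rule ext, clarify)
    fix g and x :: "'m Diff"
    show "alg_coarse C (\<lambda>m :: 'm. (0, diff_of m)) (g, x) = alg_fine R (g, x)"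
      unfolding alg_coarse_eq[OF C] alg_fine_def
      by (auto simp: C_def in_keys_iff zero split: if_splits)
  qed
  with graded_ring_alg_coarse[OF C d] show ?thesis by simp
qed

end

theory Submission
  imports Defs
begin

text \<open>
  Constants \<open>r e_0\<close> with \<open>r\<close> a homogeneous unit are always homogeneous units, so only the
  opposite inclusions matter. The statements compare as follows: every element homogeneous for
  the fine graduation is homogeneous for the coarse one, which gives that (i) implies (ii); if
  \<open>m + n = 0\<close> then \<open>e_m e_n = 1\<close>, so an invertible \<open>m \<noteq> 0\<close> would yield a non-constant unit,
  which gives that (ii) implies (iii) over a nonzero ring; and since an entire graded ring is
  reduced, (iii) implies (i) is the case \<open>d = 0\<close> of part b).

  The units are constant for the following reason. In a sharp monoid \<open>m + n = 0\<close> forces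
  \<open>m = n = 0\<close>, so \<open>p q = 1\<close> gives \<open>p_0 q_0 = 1\<close> for the coefficients at \<open>0\<close>. Hence
  \<open>p_m = p_m p_0 q_0\<close>, and it is enough to see that this product vanishes for \<open>m \<noteq> 0\<close>
  (\<open>sharp_unit_const\<close>). For the fine graduation it does because \<open>p\<close> has at most one nonzero
  coefficient. For the coarse graduation with \<open>R\<close> reduced it does because
  \<open>p_m q_n = 0\<close> whenever \<open>m + n \<noteq> 0\<close>. A conceptual argument for the last fact passes to the
  quotients by the graded primes, over which \<open>p\<close> and \<open>q\<close> become monomials; the proof below
  replaces the primes by the elementary lemma \<open>coeff_products_vanish_above\<close>. It uses a total order
  on \<open>M\<close>, obtained from a maximal cone in the torsionfree group \<open>Diff(M)\<close>
  (\<open>torsionfree_group_orderable\<close>), and it uses that the inverse of a homogeneous element can be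
  chosen homogeneous (\<open>homogeneous_inverse\<close>), so that all products \<open>p_m q_n\<close> are homogeneous and
  reducedness applies to them.
\<close>

section \<open>Ordering torsionfree groups\<close>

definition group_cone :: "'g::ab_group_add set \<Rightarrow> bool" where
  "group_cone P \<longleftrightarrow> 0 \<in> P \<and> (\<forall>x\<in>P. \<forall>y\<in>P. x + y \<in> P) \<and> (\<forall>x\<in>P. - x \<in> P \<longrightarrow> x = 0)"

lemma cone_multiple:
  assumes "group_cone P" "x \<in> P"
  shows "(\<Sum>_<n::nat. x) \<in> P"
  by (induction n) (use assms in \<open>auto simp: group_cone_def add.commute\<close>)

lemma sum_const_add:
  fixes x :: "'a::comm_monoid_add" and m n :: nat
  shows "(\<Sum>_<m + n. x) = (\<Sum>_<m. x) + (\<Sum>_<n. x)"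
  by (induction n) (simp_all add: ac_simps)

lemma sum_const_mult:
  fixes x :: "'a::comm_monoid_add" and m n :: nat
  shows "(\<Sum>_<m * n. x) = (\<Sum>_<n. \<Sum>_<m. x)"
  by (induction n) (simp_all add: sum_const_add ac_simps)

text \<open>
  Adjoining \<open>x\<close> to a cone \<open>P\<close> yields the set of all \<open>p + n x\<close>. If this is not a cone, then two
  of its elements cancel, and collecting the multiples of \<open>x\<close> exhibits a multiple of \<open>- x\<close> in \<open>P\<close>.
\<close>

lemma maximal_cone_obstruction:
  fixes P :: "'g::ab_group_add set"
  assumes P: "group_cone P" and max: "\<And>Q. group_cone Q \<Longrightarrow> P \<subseteq> Q \<Longrightarrow> Q = P"
    and x: "x \<notin> P"
  shows "\<exists>n. n > (0::nat) \<and> - (\<Sum>_<n. x) \<in> P"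
proof (rule ccontr)
  assume none: "\<not> ?thesis"
  define Q where "Q = {p + (\<Sum>_<n. x) | p n :: nat. p \<in> P}"
  have P0: "0 \<in> P" and Padd: "a \<in> P \<Longrightarrow> b \<in> P \<Longrightarrow> a + b \<in> P"
    and Pneg: "a \<in> P \<Longrightarrow> - a \<in> P \<Longrightarrow> a = 0" for a b
    using P by (auto simp: group_cone_def)
  have Qadd: "a + b \<in> Q" if ab: "a \<in> Q" "b \<in> Q" for a b
  proof -
    obtain p n q m where *: "p \<in> P" "q \<in> P" "a = p + (\<Sum>_<n::nat. x)" "b = q + (\<Sum>_<m::nat. x)"
      using ab unfolding Q_def by blast
    then have "a + b = (p + q) + (\<Sum>_<n + m. x)"
      unfolding sum_const_add by (simp add: ac_simps)
    with *(1,2) Padd show ?thesis unfolding Q_def by blast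
  qed
  have Qneg: "a = 0" if a: "a \<in> Q" "- a \<in> Q" for a
  proof -
    obtain p n q m where *: "p \<in> P" "q \<in> P" "a = p + (\<Sum>_<n::nat. x)" "- a = q + (\<Sum>_<m::nat. x)"
      using a unfolding Q_def by blast
    have "0 = a + - a" by simp
    also have "\<dots> = (p + q) + (\<Sum>_<n + m. x)"
      unfolding sum_const_add *(4) by (simp add: *(3) ac_simps)
    finally have eq: "- (\<Sum>_<n + m. x) = p + q"
      by (simp add: neg_eq_iff_add_eq_0 add.commute)
    have "- (\<Sum>_<n + m. x) \<in> P" unfolding eq by (rule Padd[OF *(1,2)])
    with none have "\<not> n + m > 0" by metis
    then have nm: "n = 0" "m = 0" by simp_all
    have "a = p" using *(3) unfolding nm by simp
    moreover have "- a = q" using *(4) unfolding nm by simp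
    ultimately show ?thesis using *(1,2) Pneg by metis
  qed
  have sub: "P \<subseteq> Q"
  proof
    fix p assume "p \<in> P"
    then have "p + (\<Sum>_<0::nat. x) \<in> Q" unfolding Q_def by blast
    then show "p \<in> Q" by simp
  qed
  have "0 + (\<Sum>_<1::nat. x) \<in> Q" unfolding Q_def using P0 by blast
  then have "x \<in> Q" by simp
  moreover have "group_cone Q"
    unfolding group_cone_def using sub P0 Qadd Qneg by blast
  ultimately show False using max[OF _ sub] x by blast
qed

text \<open>
  A maximal cone \<open>P\<close> orders the group: if neither \<open>x\<close> nor \<open>- x\<close> lies in \<open>P\<close>, then positive
  multiples of both do, so a common multiple of \<open>x\<close> lies in \<open>P\<close> together with its opposite and
  vanishes.
\<close>

lemma torsionfree_group_orderable:
  assumes tf: "torsionfree_group TYPE('g::ab_group_add)"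
  shows "\<exists>P :: 'g set. group_cone P \<and> (\<forall>x. x \<in> P \<or> - x \<in> P)"
proof -
  have "\<exists>P\<in>{P :: 'g set. group_cone P}. \<forall>Q\<in>{P. group_cone P}. P \<subseteq> Q \<longrightarrow> Q = P"
  proof (rule subset_Zorn_nonempty)
    show "{P :: 'g set. group_cone P} \<noteq> {}"
      by (auto simp: group_cone_def intro!: exI[of _ "{0}"])
  next
    fix \<C> :: "'g set set"
    assume ne: "\<C> \<noteq> {}" and chain: "subset.chain {P. group_cone P} \<C>"
    have cone: "group_cone P" if "P \<in> \<C>" for P
      using chain that unfolding subset.chain_def by blast
    \<comment> \<open>By linearity of the chain, any two elements of the union lie in one of its cones.\<close>
    have common: "\<exists>P\<in>\<C>. x \<in> P \<and> y \<in> P" if "x \<in> \<Union>\<C>" "y \<in> \<Union>\<C>" for x y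
      using chain that unfolding subset_chain_def by blast
    have "0 \<in> \<Union>\<C>" using ne cone unfolding group_cone_def by blast
    moreover have "x + y \<in> \<Union>\<C>" if "x \<in> \<Union>\<C>" "y \<in> \<Union>\<C>" for x y
      using common[OF that] cone unfolding group_cone_def by blast
    moreover have "x = 0" if "x \<in> \<Union>\<C>" "- x \<in> \<Union>\<C>" for x
      using common[OF that] cone unfolding group_cone_def by blast
    ultimately show "\<Union>\<C> \<in> {P. group_cone P}" unfolding group_cone_def by blast
  qed
  then obtain P :: "'g set" where P: "group_cone P"
    and max: "\<And>Q. group_cone Q \<Longrightarrow> P \<subseteq> Q \<Longrightarrow> Q = P" by auto
  have "x \<in> P \<or> - x \<in> P" for x
  proof (rule ccontr)
    assume "\<not> (x \<in> P \<or> - x \<in> P)"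
    then have x: "x \<notin> P" and mx: "- x \<notin> P" by auto
    obtain k :: nat where k: "k > 0" "- (\<Sum>_<k. x) \<in> P"
      using maximal_cone_obstruction[OF P max x] by blast
    obtain l :: nat where l: "l > 0" "- (\<Sum>_<l. - x) \<in> P"
      using maximal_cone_obstruction[OF P max mx] by blast
    have "(\<Sum>_<k. - (\<Sum>_<l. - x)) \<in> P" using cone_multiple[OF P l(2)] .
    then have pos: "(\<Sum>_<l * k. x) \<in> P" by (simp add: sum_negf sum_const_mult del: sum_constant)
    have "(\<Sum>_<l. - (\<Sum>_<k. x)) \<in> P" using cone_multiple[OF P k(2)] .
    then have "- (\<Sum>_<k * l. x) \<in> P" by (simp add: sum_negf sum_const_mult del: sum_constant)
    with pos have "(\<Sum>_<l * k. x) = 0"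
      using P by (simp add: group_cone_def mult.commute)
    with tf k(1) l(1) have "x = 0"
      unfolding torsionfree_group_def by (blast intro: mult_pos_pos)
    with x P show False by (simp add: group_cone_def)
  qed
  with P show ?thesis by blast
qed

definition translation_order :: "('m::comm_monoid_add \<Rightarrow> 'm \<Rightarrow> bool) \<Rightarrow> bool" where
  "translation_order lt \<longleftrightarrow>
    (\<forall>a. \<not> lt a a) \<and> (\<forall>a b c. lt a b \<longrightarrow> lt b c \<longrightarrow> lt a c) \<and>
    (\<forall>a b. a = b \<or> lt a b \<or> lt b a) \<and> (\<forall>a b c. lt a b \<longrightarrow> lt (a + c) (b + c))"

lemma translation_order_converse:
  assumes "translation_order lt"
  shows "translation_order (\<lambda>a b. lt b a)"
  using assms unfolding translation_order_def by (elim conjE, intro conjI) metis+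

lemma torsionfree_monoid_orderable:
  assumes c: "cancellable_monoid TYPE('m::comm_monoid_add)" and tf: "torsionfree_monoid TYPE('m)"
  shows "\<exists>lt :: 'm \<Rightarrow> 'm \<Rightarrow> bool. translation_order lt"
proof -
  obtain P :: "'m Diff set" where P: "group_cone P" and tot: "\<And>x. x \<in> P \<or> - x \<in> P"
    using torsionfree_group_orderable[OF tf[unfolded torsionfree_monoid_def]] by metis
  have Padd: "a \<in> P \<Longrightarrow> b \<in> P \<Longrightarrow> a + b \<in> P"
    and Pneg: "a \<in> P \<Longrightarrow> - a \<in> P \<Longrightarrow> a = 0" for a b
    using P by (auto simp: group_cone_def)
  have inj: "diff_of a = diff_of b \<longleftrightarrow> a = b" for a b :: 'm
    using c unfolding cancellable_monoid_iff_inj by (auto dest: injD)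
  have plus: "diff_of (a + b) = diff_of a + diff_of b" for a b :: 'm
    using monoid_morphism_diff_of[where ?'a = 'm] by (simp add: monoid_morphism_def)
  define lt where "lt a b \<longleftrightarrow> a \<noteq> b \<and> diff_of b - diff_of a \<in> P" for a b :: 'm
  have antisym: "\<not> (lt a b \<and> lt b a)" for a b
    using Pneg[of "diff_of b - diff_of a"] inj[of b a] by (auto simp: lt_def)
  have tr: "lt a d" if ab: "lt a b" and bd: "lt b d" for a b d
  proof -
    have "diff_of d - diff_of a \<in> P"
      using ab bd Padd[of "diff_of b - diff_of a" "diff_of d - diff_of b"] by (simp add: lt_def)
    moreover have "a \<noteq> d" using antisym ab bd by blast
    ultimately show ?thesis by (simp add: lt_def)
  qed
  have total: "a = b \<or> lt a b \<or> lt b a" for a b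
    using tot[of "diff_of b - diff_of a"] by (auto simp: lt_def)
  have shift: "lt (a + d) (b + d)" if "lt a b" for a b d
    using that c by (auto simp: lt_def plus cancellable_monoid_def)
  have irr: "\<not> lt a a" for a by (simp add: lt_def)
  have "translation_order lt"
    unfolding translation_order_def by (intro conjI allI impI; (fact irr total shift | erule (1) tr))
  then show ?thesis by blast
qed

section \<open>Homogeneous elements of graded rings\<close>

lemma graded_ring_decomposition:
  assumes "graded_ring A"
  obtains u where "\<And>g. Poly_Mapping.lookup u g \<in> A g"
    "y = (\<Sum>g\<in>Poly_Mapping.keys u. Poly_Mapping.lookup u g)"
proof -
  have "\<exists>!u. (\<forall>g. Poly_Mapping.lookup u g \<in> A g) \<and>
      y = (\<Sum>g\<in>Poly_Mapping.keys u. Poly_Mapping.lookup u g)"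
    using assms by (simp add: graded_ring_def direct_sum_family_def)
  then show thesis using that by (elim ex1E conjE) blast
qed

text \<open>
  Multiplication by \<open>x\<close> shifts degrees by \<open>g\<close>, so if \<open>x y\<close> is homogeneous then it comes from a
  single component of \<open>y\<close>.
\<close>

lemma homogeneous_mult_component:
  fixes A :: "'g::ab_group_add \<Rightarrow> 'a::comm_ring set"
  assumes A: "graded_ring A" and x: "x \<in> A g"
    and u: "\<And>h. Poly_Mapping.lookup u h \<in> A h"
    and z: "x * (\<Sum>h\<in>Poly_Mapping.keys u. Poly_Mapping.lookup u h) \<in> A k" (is "?z \<in> _")
  shows "x * Poly_Mapping.lookup u (k - g) = ?z"
proof -
  have A0: "0 \<in> A h" and Aadd: "a \<in> A h \<Longrightarrow> b \<in> A h \<Longrightarrow> a + b \<in> A h"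
    and Aneg: "a \<in> A h \<Longrightarrow> - a \<in> A h"
    and Amult: "a \<in> A h \<Longrightarrow> b \<in> A l \<Longrightarrow> a * b \<in> A (h + l)" for a b h l
    using A unfolding graded_ring_def by auto
  let ?F = "\<lambda>l. x * Poly_Mapping.lookup u (l - g) + (if l = k then - ?z else 0)"
  let ?T = "(\<lambda>h. h + g) ` Poly_Mapping.keys u"
  have out: "Poly_Mapping.lookup u (l - g) = 0" if "l \<notin> ?T" for l
  proof -
    have "l - g \<notin> Poly_Mapping.keys u" using that by (metis diff_add_cancel image_eqI)
    then show ?thesis by (simp add: in_keys_iff)
  qed
  have "?F k = 0"
  proof (rule graded_ring_direct_sum_zero[OF A, of "insert k ?T" ?F])
    show "?F l \<in> A l" for l
    proof -
      have "x * Poly_Mapping.lookup u (l - g) \<in> A l" using Amult[OF x u, of "l - g"] by simp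
      moreover have "(if l = k then - ?z else 0) \<in> A l" using Aneg[OF z] A0 by simp
      ultimately show ?thesis by (rule Aadd)
    qed
    show "?F l = 0" if "l \<notin> insert k ?T" for l
      using that out[of l] by simp
    have "(\<Sum>l\<in>insert k ?T. x * Poly_Mapping.lookup u (l - g))
        = (\<Sum>l\<in>?T. x * Poly_Mapping.lookup u (l - g))"
      by (rule sum.mono_neutral_right) (use out in auto)
    also have "\<dots> = ?z"
      by (subst sum.reindex) (auto simp: inj_on_def sum_distrib_left)
    finally have 1: "(\<Sum>l\<in>insert k ?T. x * Poly_Mapping.lookup u (l - g)) = ?z" .
    have 2: "(\<Sum>l\<in>insert k ?T. if l = k then - ?z else 0) = - ?z"
      by (subst sum.delta) simp_all
    show "(\<Sum>l\<in>insert k ?T. ?F l) = 0"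
      unfolding sum.distrib 1 2 by simp
  qed simp
  then show ?thesis by simp
qed

lemma graded_ring_one:
  fixes R :: "'g::ab_group_add \<Rightarrow> 'r::{comm_ring, comm_monoid_mult} set"
  assumes R: "graded_ring R"
  shows "1 \<in> R 0"
proof -
  obtain u where u: "\<And>g. Poly_Mapping.lookup u g \<in> R g"
      and one: "1 = (\<Sum>g\<in>Poly_Mapping.keys u. Poly_Mapping.lookup u g)"
    using graded_ring_decomposition[OF R, of 1] by metis
  \<comment> \<open>The degree-zero part of \<open>1\<close> acts as an identity on homogeneous elements, hence on \<open>1\<close>.\<close>
  have hom: "x * Poly_Mapping.lookup u 0 = x" if "x \<in> R h" for x h
    using homogeneous_mult_component[OF R that u, of h] that by (simp flip: one)
  have "Poly_Mapping.lookup u 0 =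
      (\<Sum>g\<in>Poly_Mapping.keys u. Poly_Mapping.lookup u g) * Poly_Mapping.lookup u 0"
    by (simp flip: one)
  also have "\<dots> = 1"
    unfolding sum_distrib_right hom[OF u] by (rule one[symmetric])
  finally show ?thesis using u[of 0] by simp
qed

lemma homogeneous_inverse:
  fixes A :: "'g::ab_group_add \<Rightarrow> 'a::comm_ring set"
  assumes A: "graded_ring A" and e: "e \<in> A 0" and x: "x \<in> A g" and xy: "x * y = e"
  shows "\<exists>z\<in>A (- g). x * z = e"
proof -
  obtain u where u: "\<And>g. Poly_Mapping.lookup u g \<in> A g"
      and y: "y = (\<Sum>g\<in>Poly_Mapping.keys u. Poly_Mapping.lookup u g)"
    using graded_ring_decomposition[OF A, of y] by metis
  have "x * Poly_Mapping.lookup u (- g) = e"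
    using homogeneous_mult_component[OF A x u, of 0] e xy by (simp flip: y)
  with u show ?thesis by blast
qed

lemma entire_graded_reduced:
  fixes R :: "'g::ab_group_add \<Rightarrow> 'r::{comm_ring, comm_monoid_mult} set"
  assumes "entire_graded R"
  shows "reduced_graded R"
proof -
  have nz: "y = 0" if "x \<in> homogeneous R" "x \<noteq> 0" "x * y = 0" for x y
    using assms that unfolding entire_graded_def by blast
  have one: "(1 :: 'r) \<noteq> 0"
  proof
    assume "(1 :: 'r) = 0"
    then have "x = 0" for x :: 'r by (metis mult_1_left mult_zero_left)
    with assms show False by (simp add: entire_graded_def)
  qed
  have "x ^ n \<noteq> 0" if "x \<in> homogeneous R" "x \<noteq> 0" for x n
    by (induction n) (use one nz[OF that] in auto)
  then show ?thesis unfolding reduced_graded_def by blast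
qed

section \<open>Coefficients of products in monoid algebras\<close>

lemma lookup_mult_keys:
  fixes p q :: "'m::comm_monoid_add \<Rightarrow>\<^sub>0 'r::comm_ring"
  shows "Poly_Mapping.lookup (p * q) k =
    (\<Sum>(m, n)\<in>{(m, n) \<in> Poly_Mapping.keys p \<times> Poly_Mapping.keys q. m + n = k}.
      Poly_Mapping.lookup p m * Poly_Mapping.lookup q n)"
proof -
  have "p * q = (\<Sum>m\<in>Poly_Mapping.keys p. \<Sum>n\<in>Poly_Mapping.keys q.
      Poly_Mapping.single (m + n) (Poly_Mapping.lookup p m * Poly_Mapping.lookup q n))"
    by (subst poly_mapping_decomp[of p], subst poly_mapping_decomp[of q]) (simp add: sum_product mult_single)
  then have "Poly_Mapping.lookup (p * q) k = (\<Sum>(m, n)\<in>Poly_Mapping.keys p \<times> Poly_Mapping.keys q.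
      if m + n = k then Poly_Mapping.lookup p m * Poly_Mapping.lookup q n else 0)"
    by (simp add: lookup_sum lookup_single when_def sum.cartesian_product case_prod_unfold)
  also have "\<dots> = (\<Sum>(m, n)\<in>{(m, n) \<in> Poly_Mapping.keys p \<times> Poly_Mapping.keys q. m + n = k}.
      Poly_Mapping.lookup p m * Poly_Mapping.lookup q n)"
    by (rule sum.mono_neutral_cong_right) (auto split: if_splits)
  finally show ?thesis .
qed

text \<open>
  Descending induction on the degree \<open>s = a + b\<close>, as in the proof that reduced rings are
  Armendariz. Multiply the vanishing coefficient of \<open>p q\<close> at \<open>s\<close> by \<open>p_a q_b\<close>. For any other pair
  \<open>(m, n)\<close> with \<open>m + n = s\<close>, one of \<open>m + b\<close> and \<open>a + n\<close> exceeds \<open>s\<close>, so \<open>p_m q_b = 0\<close> or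
  \<open>p_a q_n = 0\<close> by induction; only the square of \<open>p_a q_b\<close> survives.
\<close>

lemma coeff_products_vanish_above:
  fixes p q :: "'m::comm_monoid_add \<Rightarrow>\<^sub>0 'r::comm_ring"
  assumes ord: "translation_order lt"
    and zero: "\<And>s. lt c s \<Longrightarrow> Poly_Mapping.lookup (p * q) s = 0"
    and red: "\<And>m n. (Poly_Mapping.lookup p m * Poly_Mapping.lookup q n)
        * (Poly_Mapping.lookup p m * Poly_Mapping.lookup q n) = 0
        \<Longrightarrow> Poly_Mapping.lookup p m * Poly_Mapping.lookup q n = 0"
    and "lt c (a + b)"
  shows "Poly_Mapping.lookup p a * Poly_Mapping.lookup q b = 0"
proof -
  let ?p = "Poly_Mapping.lookup p" and ?q = "Poly_Mapping.lookup q"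
  define S where "S = (\<lambda>(m, n). m + n) ` (Poly_Mapping.keys p \<times> Poly_Mapping.keys q)"
  have fin: "finite S" by (simp add: S_def)
  have irr: "\<not> lt x x" and tr: "lt x y \<Longrightarrow> lt y z \<Longrightarrow> lt x z"
    and tot: "x = y \<or> lt x y \<or> lt y x" and shift: "lt x y \<Longrightarrow> lt (x + z) (y + z)" for x y z
    using ord unfolding translation_order_def by blast+
  have shift': "lt x y \<Longrightarrow> lt (z + x) (z + y)" for x y z
    using shift by (simp add: add.commute)
  have "\<forall>a b. a + b = s \<longrightarrow> ?p a * ?q b = 0" if "lt c s" for s
    using that
  proof (induction "card {t \<in> S. lt s t}" arbitrary: s rule: less_induct)
    case less
    have IH: "?p m * ?q n = 0" if "lt s (m + n)" for m n
    proof (cases "m + n \<in> S")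
      case True
      have "{t \<in> S. lt (m + n) t} \<subset> {t \<in> S. lt s t}"
        using True that irr tr by blast
      then have "card {t \<in> S. lt (m + n) t} < card {t \<in> S. lt s t}"
        by (rule psubset_card_mono[rotated]) (simp add: fin)
      with less.hyps less.prems that tr show ?thesis by blast
    next
      case False
      then have "m \<notin> Poly_Mapping.keys p \<or> n \<notin> Poly_Mapping.keys q" by (auto simp: S_def)
      then show ?thesis by (auto simp: in_keys_iff)
    qed
    show ?case
    proof (intro allI impI)
      fix a b assume ab: "a + b = s"
      let ?K = "{(m, n) \<in> Poly_Mapping.keys p \<times> Poly_Mapping.keys q. m + n = s}"
      show "?p a * ?q b = 0"
      proof (cases "(a, b) \<in> ?K")
        case False
        then show ?thesis using ab by (auto simp: in_keys_iff)
      next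
        case True
        have other: "(?p a * ?q b) * (?p m * ?q n) = 0"
          if mn: "m + n = s" and ne: "(m, n) \<noteq> (a, b)" for m n
        proof -
          have "lt m a \<or> lt a m \<or> (m = a \<and> n \<noteq> b)" using tot ne by blast
          then consider "lt m a" | "lt a m" | "m = a" "n \<noteq> b" by blast
          then have "lt s (a + n) \<or> lt s (m + b)"
          proof cases
            case 1
            then show ?thesis using shift mn by blast
          next
            case 2
            then show ?thesis using shift ab by blast
          next
            case 3
            then show ?thesis using tot[of n b] shift' mn ab irr by metis
          qed
          then have "?p a * ?q n = 0 \<or> ?p m * ?q b = 0" using IH by blast
          moreover have "(?p a * ?q b) * (?p m * ?q n) = (?p a * ?q n) * (?p m * ?q b)"
            by (simp add: ac_simps)
          ultimately show ?thesis by auto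
        qed
        have fK: "finite ?K"
          by (rule finite_subset[of _ "Poly_Mapping.keys p \<times> Poly_Mapping.keys q"]) auto
        have "0 = (?p a * ?q b) * Poly_Mapping.lookup (p * q) s"
          using zero[OF less.prems] by simp
        also have "\<dots> = (\<Sum>z\<in>?K. (?p a * ?q b) * (?p (fst z) * ?q (snd z)))"
          unfolding lookup_mult_keys by (simp add: sum_distrib_left case_prod_unfold)
        also have "\<dots> = (\<Sum>z\<in>{(a, b)}. (?p a * ?q b) * (?p (fst z) * ?q (snd z)))"
          using fK
        proof (rule sum.mono_neutral_right)
          show "{(a, b)} \<subseteq> ?K" using True by blast
          show "\<forall>z\<in>?K - {(a, b)}. (?p a * ?q b) * (?p (fst z) * ?q (snd z)) = 0"
          proof
            fix z assume "z \<in> ?K - {(a, b)}"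
            then have "fst z + snd z = s" "(fst z, snd z) \<noteq> (a, b)" by auto
            then show "(?p a * ?q b) * (?p (fst z) * ?q (snd z)) = 0" by (rule other)
          qed
        qed
        finally have "(?p a * ?q b) * (?p a * ?q b) = 0" by simp
        then show ?thesis by (rule red)
      qed
    qed
  qed
  with assms(4) show ?thesis by blast
qed

lemma sharp_unit_const:
  fixes p q :: "'m::comm_monoid_add \<Rightarrow>\<^sub>0 'r::{comm_ring, comm_monoid_mult}"
  assumes sharp: "sharp_monoid TYPE('m)" and pq: "p * q = alg_one"
    and vanish: "\<And>m. m \<noteq> 0 \<Longrightarrow>
      Poly_Mapping.lookup p m * (Poly_Mapping.lookup p 0 * Poly_Mapping.lookup q 0) = 0"
  shows "p = alg_const (Poly_Mapping.lookup p 0)"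
    and "Poly_Mapping.lookup p 0 * Poly_Mapping.lookup q 0 = 1"
proof -
  have "m + n = 0 \<longleftrightarrow> m = 0 \<and> n = 0" for m n :: 'm
    using sharp unfolding sharp_monoid_def by (metis add_0_left)
  then have K: "{(m, n) \<in> Poly_Mapping.keys p \<times> Poly_Mapping.keys q. m + n = 0} =
      {(m, n). m = 0 \<and> n = 0 \<and> 0 \<in> Poly_Mapping.keys p \<and> 0 \<in> Poly_Mapping.keys q}"
    by auto
  have "1 = Poly_Mapping.lookup (p * q) 0" by (simp add: pq alg_one_def)
  also have "\<dots> = (\<Sum>(m, n)\<in>{(0, 0)}. Poly_Mapping.lookup p m * Poly_Mapping.lookup q n)"
    unfolding lookup_mult_keys K by (rule sum.mono_neutral_left) (auto simp: in_keys_iff)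
  finally show unit: "Poly_Mapping.lookup p 0 * Poly_Mapping.lookup q 0 = 1" by simp
  have "Poly_Mapping.lookup p m = 0" if "m \<noteq> 0" for m
    using vanish[OF that] unfolding unit by simp
  then show "p = alg_const (Poly_Mapping.lookup p 0)"
    by (intro poly_mapping_eqI) (auto simp: alg_const_def lookup_single when_def)
qed

section \<open>Homogeneous units of monoid algebras\<close>

lemma const_homogeneous_units:
  fixes R :: "'g \<Rightarrow> 'r::{comm_ring, comm_monoid_mult} set"
    and A :: "'h \<Rightarrow> ('m::comm_monoid_add \<Rightarrow>\<^sub>0 'r) set"
  assumes "\<And>r. r \<in> homogeneous R \<Longrightarrow> alg_const r \<in> homogeneous A"
  shows "alg_const ` homogeneous_units 1 R \<subseteq> homogeneous_units alg_one A"
proof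
  fix p assume "p \<in> (alg_const ` homogeneous_units 1 R :: ('m \<Rightarrow>\<^sub>0 'r) set)"
  then obtain r s where r: "r \<in> homogeneous R" "r * s = 1" "p = alg_const r"
    by (auto simp: homogeneous_units_def)
  have "p * alg_const s = alg_one"
    by (simp add: r alg_const_def alg_one_def mult_single)
  with r assms show "p \<in> homogeneous_units alg_one A"
    unfolding homogeneous_units_def by blast
qed

lemma const_units_coarse:
  fixes R :: "'g::ab_group_add \<Rightarrow> 'r::{comm_ring, comm_monoid_mult} set"
    and d :: "'m::comm_monoid_add \<Rightarrow> 'g"
  shows "alg_const ` homogeneous_units 1 R \<subseteq> homogeneous_units alg_one (alg_coarse R d)"
proof (rule const_homogeneous_units)
  fix r assume "r \<in> homogeneous R"
  then obtain g where "r \<in> R g" by (auto simp: homogeneous_def)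
  then have "alg_const r \<in> alg_coarse R d (g + d 0)"
    by (auto simp: alg_coarse_def alg_const_def split: if_splits)
  then show "alg_const r \<in> homogeneous (alg_coarse R d)" by (auto simp: homogeneous_def)
qed

lemma const_units_fine:
  fixes R :: "'g::ab_group_add \<Rightarrow> 'r::{comm_ring, comm_monoid_mult} set"
  shows "alg_const ` homogeneous_units 1 R \<subseteq>
    homogeneous_units alg_one (alg_fine R :: 'g \<times> 'm::comm_monoid_add Diff \<Rightarrow> ('m \<Rightarrow>\<^sub>0 'r) set)"
proof (rule const_homogeneous_units)
  fix r assume "r \<in> homogeneous R"
  then obtain g where "r \<in> R g" by (auto simp: homogeneous_def)
  then have "(alg_const r :: 'm \<Rightarrow>\<^sub>0 'r) \<in> alg_fine R (g, diff_of 0)"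
    by (auto simp: alg_fine_def alg_const_def split: if_splits)
  then show "(alg_const r :: 'm \<Rightarrow>\<^sub>0 'r) \<in> homogeneous (alg_fine R)"
    unfolding homogeneous_def by blast
qed

lemma fine_units_subset_coarse_units:
  fixes R :: "'g::ab_group_add \<Rightarrow> 'r::{comm_ring, comm_monoid_mult} set"
  shows "homogeneous_units alg_one (alg_fine R :: 'g \<times> 'm::comm_monoid_add Diff \<Rightarrow> ('m \<Rightarrow>\<^sub>0 'r) set)
    \<subseteq> homogeneous_units alg_one (alg_coarse R (\<lambda>_. 0))"
proof -
  have "alg_fine R (g, x) \<subseteq> (alg_coarse R (\<lambda>_. 0) g :: ('m \<Rightarrow>\<^sub>0 'r) set)" for g and x :: "'m Diff"
    by (auto simp: alg_fine_def alg_coarse_def)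
  then have "homogeneous (alg_fine R :: 'g \<times> 'm Diff \<Rightarrow> ('m \<Rightarrow>\<^sub>0 'r) set)
      \<subseteq> homogeneous (alg_coarse R (\<lambda>_. 0))"
    unfolding homogeneous_def by fast
  then show ?thesis unfolding homogeneous_units_def by blast
qed

lemma fine_units_const:
  fixes R :: "'g::ab_group_add \<Rightarrow> 'r::{comm_ring, comm_monoid_mult} set"
  assumes R: "graded_ring R" and c: "cancellable_monoid TYPE('m::comm_monoid_add)"
    and sharp: "sharp_monoid TYPE('m)"
  shows "homogeneous_units alg_one (alg_fine R :: 'g \<times> 'm Diff \<Rightarrow> ('m \<Rightarrow>\<^sub>0 'r) set)
    \<subseteq> alg_const ` homogeneous_units 1 R"
proof
  fix p assume "p \<in> homogeneous_units alg_one (alg_fine R :: 'g \<times> 'm Diff \<Rightarrow> ('m \<Rightarrow>\<^sub>0 'r) set)"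
  then obtain g x q where p: "p \<in> alg_fine R (g, x)" and pq: "p * q = alg_one"
    by (auto simp: homogeneous_units_def homogeneous_def)
  have deg: "Poly_Mapping.lookup p m \<in> R g" "diff_of m = x" if "m \<in> Poly_Mapping.keys p" for m
    using p that by (auto simp: alg_fine_def)
  have inj: "diff_of a = diff_of b \<longleftrightarrow> a = b" for a b :: 'm
    using c unfolding cancellable_monoid_iff_inj by (auto dest: injD)
  have vanish: "Poly_Mapping.lookup p m * (Poly_Mapping.lookup p 0 * Poly_Mapping.lookup q 0) = 0"
    if "m \<noteq> 0" for m
  proof -
    have "m \<notin> Poly_Mapping.keys p \<or> 0 \<notin> Poly_Mapping.keys p"
      using deg(2) inj that by metis
    then show ?thesis by (auto simp: in_keys_iff)
  qed
  note unit = sharp_unit_const[OF sharp pq vanish]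
  have "Poly_Mapping.lookup p 0 \<in> R g"
    using deg(1)[of 0] R by (cases "0 \<in> Poly_Mapping.keys p") (auto simp: in_keys_iff graded_ring_def)
  then have "Poly_Mapping.lookup p 0 \<in> homogeneous_units 1 R"
    using unit(2) by (auto simp: homogeneous_units_def homogeneous_def)
  with unit(1) show "p \<in> alg_const ` homogeneous_units 1 R" by blast
qed

lemma sharp_if_fine_units_const:
  fixes R :: "'g::ab_group_add \<Rightarrow> 'r::{comm_ring, comm_monoid_mult} set"
  assumes R: "graded_ring R" and nz: "\<exists>x :: 'r. x \<noteq> 0"
    and ii: "homogeneous_units alg_one (alg_fine R :: 'g \<times> 'm Diff \<Rightarrow> ('m::comm_monoid_add \<Rightarrow>\<^sub>0 'r) set)
      \<subseteq> alg_const ` homogeneous_units 1 R"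
  shows "sharp_monoid TYPE('m)"
  unfolding sharp_monoid_def
proof (intro allI impI)
  fix m n :: 'm assume mn: "m + n = 0"
  have one: "(1 :: 'r) \<noteq> 0" using nz by (metis mult_1_left mult_zero_left)
  have "Poly_Mapping.single m 1 \<in> alg_fine R (0, diff_of m)"
    using graded_ring_one[OF R] by (auto simp: alg_fine_def split: if_splits)
  then have "Poly_Mapping.single m 1 \<in> homogeneous (alg_fine R :: 'g \<times> 'm Diff \<Rightarrow> _)"
    unfolding homogeneous_def by blast
  moreover have "Poly_Mapping.single m 1 * Poly_Mapping.single n 1 = (alg_one :: 'm \<Rightarrow>\<^sub>0 'r)"
    by (simp add: mult_single mn alg_one_def)
  ultimately have "Poly_Mapping.single m 1 \<in>
      homogeneous_units alg_one (alg_fine R :: 'g \<times> 'm Diff \<Rightarrow> ('m \<Rightarrow>\<^sub>0 'r) set)"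
    unfolding homogeneous_units_def by blast
  with ii obtain r :: 'r where "Poly_Mapping.single m 1 = Poly_Mapping.single 0 r"
    by (auto simp: alg_const_def)
  then have "Poly_Mapping.lookup (Poly_Mapping.single 0 r) m = 1"
    by (metis lookup_single_eq)
  with one show "m = 0" by (auto simp: lookup_single when_def split: if_splits)
qed

text \<open>
  For \<open>p q = 1\<close> with \<open>q\<close> homogeneous, the coefficients of \<open>p q\<close> above \<open>0\<close> and below \<open>0\<close> vanish.
  Applying \<open>coeff_products_vanish_above\<close> to an order and to its converse yields \<open>p_m q_0 = 0\<close> for
  all \<open>m \<noteq> 0\<close>.
\<close>

lemma coarse_units_const:
  fixes R :: "'g::ab_group_add \<Rightarrow> 'r::{comm_ring, comm_monoid_mult} set"
    and d :: "'m::comm_monoid_add \<Rightarrow> 'g"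
  assumes R: "graded_ring R" and sharp: "sharp_monoid TYPE('m)"
    and tf: "torsionfree_monoid TYPE('m)" and c: "cancellable_monoid TYPE('m)"
    and d: "monoid_morphism d" and red: "reduced_graded R"
  shows "homogeneous_units alg_one (alg_coarse R d) \<subseteq> alg_const ` homogeneous_units 1 R"
proof
  fix p assume "p \<in> homogeneous_units alg_one (alg_coarse R d)"
  then obtain g q' where p: "p \<in> alg_coarse R d g" and pq': "p * q' = alg_one"
    by (auto simp: homogeneous_units_def homogeneous_def)
  have d0: "d 0 = 0" using d by (simp add: monoid_morphism_def)
  have "alg_one \<in> alg_coarse R d 0"
    using graded_ring_one[OF R] d0 by (auto simp: alg_coarse_def alg_one_def split: if_splits)
  then obtain q where q: "q \<in> alg_coarse R d (- g)" and pq: "p * q = alg_one"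
    using homogeneous_inverse[OF graded_ring_alg_coarse[OF R d] _ p pq'] by blast
  let ?p = "Poly_Mapping.lookup p" and ?q = "Poly_Mapping.lookup q"
  have pR: "?p m \<in> R (g - d m)" and qR: "?q m \<in> R (- g - d m)" for m
    using p q unfolding alg_coarse_eq[OF R] by blast+
  have reduced: "?p m * ?q n = 0" if "(?p m * ?q n) * (?p m * ?q n) = 0" for m n
  proof -
    have "?p m * ?q n \<in> homogeneous R"
      using R pR qR unfolding graded_ring_def homogeneous_def by blast
    moreover have "(?p m * ?q n) ^ 2 = 0" using that by (simp add: power2_eq_square)
    ultimately show ?thesis using red unfolding reduced_graded_def by blast
  qed
  have zero: "Poly_Mapping.lookup (p * q) s = 0" if "s \<noteq> 0" for s
    using that by (simp add: pq alg_one_def lookup_single when_def)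
  obtain lt :: "'m \<Rightarrow> 'm \<Rightarrow> bool" where lt: "translation_order lt"
    using torsionfree_monoid_orderable[OF c tf] by blast
  have irr: "\<not> lt a a" for a using lt unfolding translation_order_def by blast
  have vanish: "?p m * ?q 0 = 0" if "m \<noteq> 0" for m
  proof -
    have "lt 0 m \<or> lt m 0" using lt that unfolding translation_order_def by metis
    then consider "lt 0 (m + 0)" | "lt (m + 0) 0" by auto
    then show ?thesis
    proof cases
      case 1
      have "Poly_Mapping.lookup (p * q) s = 0" if "lt 0 s" for s
        using zero that irr by metis
      from coeff_products_vanish_above[OF lt this reduced 1] show ?thesis .
    next
      case 2
      have "Poly_Mapping.lookup (p * q) s = 0" if "lt s 0" for s
        using zero that irr by metis
      from coeff_products_vanish_above[OF translation_order_converse[OF lt] this reduced 2]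
      show ?thesis .
    qed
  qed
  have "?p m * (?p 0 * ?q 0) = 0" if "m \<noteq> 0" for m
    using vanish[OF that] by (metis mult.left_commute mult_zero_right)
  note unit = sharp_unit_const[OF sharp pq this]
  have "?p 0 \<in> homogeneous_units 1 R"
    using unit(2) pR[of 0] by (auto simp: homogeneous_units_def homogeneous_def)
  with unit(1) show "p \<in> alg_const ` homogeneous_units 1 R" by blast
qed

theorem mainTheorem6:
  fixes R :: "'g::ab_group_add \<Rightarrow> 'r::{comm_ring, comm_monoid_mult} set"
  assumes "graded_ring R"
  shows
    "(cancellable_monoid TYPE('m::comm_monoid_add) \<longrightarrow>
       (let i = (homogeneous_units alg_one (alg_coarse R (\<lambda>_ :: 'm. 0))
                   = alg_const ` homogeneous_units 1 R);
            ii = (homogeneous_units alg_one (alg_fine R :: 'g \<times> 'm Diff \<Rightarrow> _)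
                   = alg_const ` homogeneous_units 1 R);
            iii = sharp_monoid TYPE('m)
        in (i \<longrightarrow> ii) \<and>
           (iii \<longrightarrow> ii) \<and>
           ((\<exists>x :: 'r. x \<noteq> 0) \<longrightarrow> (ii \<longleftrightarrow> iii)) \<and>
           (entire_graded R \<and> torsionfree_monoid TYPE('m) \<longrightarrow>
              (i \<longleftrightarrow> ii) \<and> (ii \<longleftrightarrow> iii)))) \<and>
     (\<forall>d :: 'm \<Rightarrow> 'g.
        sharp_monoid TYPE('m) \<and> torsionfree_monoid TYPE('m) \<and> cancellable_monoid TYPE('m) \<and>
        monoid_morphism d \<and> reduced_graded R \<longrightarrow>
          homogeneous_units alg_one (alg_coarse R d) = alg_const ` homogeneous_units 1 R)" (is "(_ \<longrightarrow> ?a) \<and> _")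
proof (rule conjI[rotated], rule allI, rule impI)
  note R = \<open>graded_ring R\<close>
  fix d :: "'m \<Rightarrow> 'g"
  assume "sharp_monoid TYPE('m) \<and> torsionfree_monoid TYPE('m) \<and> cancellable_monoid TYPE('m) \<and>
    monoid_morphism d \<and> reduced_graded R"
  then have "homogeneous_units alg_one (alg_coarse R d) \<subseteq> alg_const ` homogeneous_units 1 R"
    by (intro coarse_units_const[OF R]) simp_all
  then show "homogeneous_units alg_one (alg_coarse R d) = alg_const ` homogeneous_units 1 R"
    by (rule equalityI[OF _ const_units_coarse])
next
  note R = \<open>graded_ring R\<close>
  show "cancellable_monoid TYPE('m) \<longrightarrow> ?a"
  proof
    assume c: "cancellable_monoid TYPE('m)"
    let ?C = "alg_const ` homogeneous_units 1 R :: ('m \<Rightarrow>\<^sub>0 'r) set"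
    let ?coarse = "homogeneous_units alg_one (alg_coarse R (\<lambda>_ :: 'm. 0))"
    let ?fine = "homogeneous_units alg_one (alg_fine R :: 'g \<times> 'm Diff \<Rightarrow> _)"
    define i where "i \<longleftrightarrow> ?coarse = ?C"
    define ii where "ii \<longleftrightarrow> ?fine = ?C"
    define iii where "iii \<longleftrightarrow> sharp_monoid TYPE('m)"
    have i_eq: "i \<longleftrightarrow> ?coarse \<subseteq> ?C"
      unfolding i_def using const_units_coarse by (metis equalityI order_refl)
    have ii_eq: "ii \<longleftrightarrow> ?fine \<subseteq> ?C"
      unfolding ii_def using const_units_fine by (metis equalityI order_refl)
    have i_ii: "i \<longrightarrow> ii"
      unfolding i_eq ii_eq by (intro impI subset_trans[OF fine_units_subset_coarse_units])
    have iii_ii: "iii \<longrightarrow> ii"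
      unfolding ii_eq iii_def by (intro impI fine_units_const[OF R c])
    have ii_iii: "ii \<longrightarrow> iii" if "\<exists>x :: 'r. x \<noteq> 0"
      unfolding ii_eq iii_def by (intro impI sharp_if_fine_units_const[OF R that])
    have iii_i: "iii \<longrightarrow> i" if "entire_graded R" "torsionfree_monoid TYPE('m)"
    proof -
      have "monoid_morphism (\<lambda>_ :: 'm. 0 :: 'g)" by (simp add: monoid_morphism_def)
      from coarse_units_const[OF R _ that(2) c this entire_graded_reduced[OF that(1)]]
      show ?thesis unfolding i_eq iii_def by (rule impI)
    qed
    have nz: "\<exists>x :: 'r. x \<noteq> 0" if "entire_graded R"
      using that by (simp add: entire_graded_def)
    have "(i \<longrightarrow> ii) \<and> (iii \<longrightarrow> ii) \<and> ((\<exists>x :: 'r. x \<noteq> 0) \<longrightarrow> (ii \<longleftrightarrow> iii)) \<and>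
        (entire_graded R \<and> torsionfree_monoid TYPE('m) \<longrightarrow> (i \<longleftrightarrow> ii) \<and> (ii \<longleftrightarrow> iii))"
      using i_ii iii_ii ii_iii iii_i nz by blast
    then show ?a
      unfolding Let_def i_def ii_def iii_def .
  qed
qed

end
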